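(* Let $V$ be a finite ground set, let $l\ge 1$, and let $f_1,\dots,f_l:2^V\to\mathbb{R}$ be modular functions, $f_i(X)=\sum_{j\in X} f_i(j)$, with $f_i(j)\ge 0$ for all $i$ and $j\in V$. Let $a>0$ and for $X\subseteq V$ define $$F(X)=\max_{i=1,\dots,l} f_i(X),\qquad F_a(X)=\Big(\sum_{i=1}^l [f_i(X)]^a\Big)^{1/a}.$$ Then for every $X\subseteq V$, $$F(X)\ \le\ F_a(X)\ \le\ l^{1/a}\,F(X).$$ Moreover, for a nonempty family $\mathcal C\subseteq 2^V$, given a $\beta$-approximation algorithm for minimizing $F_a$ over $\mathcal C$, one obtains a $\beta\, l^{1/a}$-approximation algorithm for the problem Robust-Min: $\min_{X\in\mathcal C}\max_{i=1,\dots,l} f_i(X)$.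
   Context: For a minimization problem $\min_{X\in\mathcal C} g(X)$ with $g\ge 0$ and a number $\beta\ge 1$, a $\beta$-approximation algorithm is a polynomial-time algorithm that outputs a set $\hat X\in\mathcal C$ with $g(\hat X)\le \beta\min_{X\in\mathcal C} g(X)$. Robust-Min is the problem $\min_{X\in\mathcal C}\max_{i} f_i(X)$ with modular non-negative $f_i$. *)

theory Defs
  imports Complex_Main "HOL-Computational_Algebra.Polynomial"
begin

section \<open>Maximum and power aggregation of modular functions\<close>

text \<open>
  A non-negative modular function on the subsets of a finite set is given by its weights on the
  elements. Below \<open>f i j\<close> is the weight of the element \<open>j\<close> in the \<open>i\<close>-th function, for
  \<open>i = 1, \<dots>, l\<close>.
\<close>

definition modular_val :: "('v \<Rightarrow> real) \<Rightarrow> 'v set \<Rightarrow> real" where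
  "modular_val w X = (\<Sum>j\<in>X. w j)"

definition F_max :: "nat \<Rightarrow> (nat \<Rightarrow> 'v \<Rightarrow> real) \<Rightarrow> 'v set \<Rightarrow> real" where
  "F_max l f X = Max ((\<lambda>i. modular_val (f i) X) ` {1..l})"

text \<open>Since \<open>0 powr a = 0\<close>, the convention \<open>0\<^sup>a = 0\<close> for \<open>a > 0\<close> is respected.\<close>

definition F_pow :: "real \<Rightarrow> nat \<Rightarrow> (nat \<Rightarrow> 'v \<Rightarrow> real) \<Rightarrow> 'v set \<Rightarrow> real" where
  "F_pow a l f X = (\<Sum>i = 1..l. modular_val (f i) X powr a) powr (1 / a)"

section \<open>Deterministic Turing machines\<close>

text \<open>
  States and tape symbols are natural numbers, \<open>0\<close> being the initial state and the blank symbol.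
  The machine has one two-way infinite tape and halts where its transition function is undefined.
  A machine is required (in \<open>approx_algorithm\<close>) to have a finite transition table; only
  finitely many states and symbols then matter.
\<close>

datatype move = Move_Left | Stay | Move_Right

fun offset :: "move \<Rightarrow> int" where
  "offset Move_Left = -1"
| "offset Stay = 0"
| "offset Move_Right = 1"

type_synonym machine = "nat \<times> nat \<rightharpoonup> nat \<times> nat \<times> move"

type_synonym config = "nat \<times> (int \<Rightarrow> nat) \<times> int"

fun halted :: "machine \<Rightarrow> config \<Rightarrow> bool" where
  "halted M (q, t, h) \<longleftrightarrow> M (q, t h) = None"

fun step :: "machine \<Rightarrow> config \<Rightarrow> config" where
  "step M (q, t, h) =
    (case M (q, t h) of
       None \<Rightarrow> (q, t, h)
     | Some (q', s, d) \<Rightarrow> (q', t(h := s), h + offset d))"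

definition bit_symbol :: "bool \<Rightarrow> nat" where
  "bit_symbol b = (if b then 2 else 1)"

definition initial :: "bool list \<Rightarrow> config" where
  "initial x =
    (0, \<lambda>i. if 0 \<le> i \<and> i < int (length x) then bit_symbol (x ! nat i) else 0, 0)"

text \<open>The output is the word that starts in cell \<open>0\<close> and is ended by a blank.\<close>

fun shows_output :: "config \<Rightarrow> bool list \<Rightarrow> bool" where
  "shows_output (q, t, h) y \<longleftrightarrow>
    (\<forall>i < length y. t (int i) = bit_symbol (y ! i)) \<and> t (int (length y)) = 0"

definition computes_within :: "machine \<Rightarrow> bool list \<Rightarrow> bool list \<Rightarrow> nat \<Rightarrow> bool" where
  "computes_within M x y T \<longleftrightarrow>
    (\<exists>k\<le>T. halted M ((step M ^^ k) (initial x)) \<and> shows_output ((step M ^^ k) (initial x)) y)"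

section \<open>Minimization problems and approximation algorithms\<close>

text \<open>
  The instances of a problem are words \<open>x\<close>; the word \<open>x\<close> stands for the task of minimizing
  \<open>objective P x\<close> over \<open>feasible P x\<close>, and an output word \<open>y\<close> stands for the set
  \<open>decode P x y\<close>.
\<close>

record 'v min_problem =
  instances :: "bool list set"
  decode :: "bool list \<Rightarrow> bool list \<Rightarrow> 'v set"
  feasible :: "bool list \<Rightarrow> 'v set set"
  objective :: "bool list \<Rightarrow> 'v set \<Rightarrow> real"

text \<open>
  The ratio may depend on the instance, because \<open>l\<close> does; a constant ratio is
  \<open>\<lambda>_. \<beta>\<close>. \<open>Min\<close> is meaningful when the family is finite and nonempty, as it is below.
\<close>

definition approx_algorithm ::
  "machine \<Rightarrow> (bool list \<Rightarrow> real) \<Rightarrow> 'v min_problem \<Rightarrow> bool" where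
  "approx_algorithm M \<beta> P \<longleftrightarrow>
    finite (dom M) \<and>
    (\<exists>p :: nat poly. \<forall>x \<in> instances P. \<exists>y.
       computes_within M x y (poly p (length x)) \<and>
       decode P x y \<in> feasible P x \<and>
       objective P x (decode P x y) \<le> \<beta> x * Min (objective P x ` feasible P x))"

section \<open>Robust minimization\<close>

record 'v robust_instance =
  ground :: "'v set"
  num :: nat
  weight :: "nat \<Rightarrow> 'v \<Rightarrow> real"
  family :: "'v set set"

definition modular_data :: "'v set \<Rightarrow> nat \<Rightarrow> (nat \<Rightarrow> 'v \<Rightarrow> real) \<Rightarrow> bool" where
  "modular_data V l f \<longleftrightarrow> finite V \<and> 1 \<le> l \<and> (\<forall>i\<in>{1..l}. \<forall>j\<in>V. 0 \<le> f i j)"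

definition valid_instance :: "'v robust_instance \<Rightarrow> bool" where
  "valid_instance R \<longleftrightarrow>
    modular_data (ground R) (num R) (weight R) \<and> family R \<subseteq> Pow (ground R) \<and> family R \<noteq> {}"

text \<open>
  A class of robust instances is given by a set \<open>I\<close> of words, the instance \<open>inst x\<close> described
  by each \<open>x \<in> I\<close>, and the reading \<open>dec x y\<close> of output words as sets. The two problems below
  differ only in the objective.
\<close>

definition robust_min ::
  "bool list set \<Rightarrow> (bool list \<Rightarrow> 'v robust_instance) \<Rightarrow> (bool list \<Rightarrow> bool list \<Rightarrow> 'v set) \<Rightarrow>
   'v min_problem" where
  "robust_min I inst dec =
    \<lparr> instances = I, decode = dec, feasible = (\<lambda>x. family (inst x)),
      objective = (\<lambda>x. F_max (num (inst x)) (weight (inst x))) \<rparr>"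

definition power_min ::
  "real \<Rightarrow> bool list set \<Rightarrow> (bool list \<Rightarrow> 'v robust_instance) \<Rightarrow>
   (bool list \<Rightarrow> bool list \<Rightarrow> 'v set) \<Rightarrow> 'v min_problem" where
  "power_min a I inst dec =
    \<lparr> instances = I, decode = dec, feasible = (\<lambda>x. family (inst x)),
      objective = (\<lambda>x. F_pow a (num (inst x)) (weight (inst x))) \<rparr>"

end

theory Submission imports Defs begin

text \<open>For non-negative numbers, the sum of the \<open>a\<close>-th powers lies between its
  largest term and \<open>l\<close> times that term; taking the \<open>a\<close>-th root, which is
  monotone, turns this into the two bounds of \<open>F_max_le_F_pow\<close> and
  \<open>F_pow_le_F_max\<close>. So \<open>F_pow\<close> approximates \<open>F_max\<close> uniformly
  on subsets of the ground set, within the factor \<open>l powr (1 / a)\<close>. A near-minimizer of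
  the surrogate is then a near-minimizer of the maximum, with this factor lost once
  (\<open>approx_min_transfer\<close>). Both problems share instances, encodings and feasible sets,
  so one machine serves both.\<close>

lemma modular_val_nonneg:
  assumes "modular_data V l f" "X \<subseteq> V" "i \<in> {1..l}"
  shows "0 \<le> modular_val (f i) X"
  using assms unfolding modular_val_def modular_data_def by (blast intro: sum_nonneg)

lemma modular_val_le_F_max:
  assumes "i \<in> {1..l}"
  shows "modular_val (f i) X \<le> F_max l f X"
  unfolding F_max_def using assms by (intro Max_ge) auto

lemma F_max_attained:
  assumes "1 \<le> l"
  obtains i where "i \<in> {1..l}" "F_max l f X = modular_val (f i) X"
proof -
  have "F_max l f X \<in> (\<lambda>i. modular_val (f i) X) ` {1..l}"
    unfolding F_max_def using assms by (intro Max_in) auto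
  then show thesis using that by auto
qed

lemma F_max_le_F_pow:
  assumes "0 < a" "modular_data V l f" "X \<subseteq> V"
  shows "F_max l f X \<le> F_pow a l f X"
proof -
  have "1 \<le> l" using assms(2) by (simp add: modular_data_def)
  then obtain i where i: "i \<in> {1..l}" "F_max l f X = modular_val (f i) X"
    by (rule F_max_attained)
  \<comment> \<open>The exponents cancel to 1, and \<open>x powr 1 = x\<close> because the value is
    non-negative.\<close>
  have "F_max l f X = (modular_val (f i) X powr a) powr (1 / a)"
    using assms modular_val_nonneg[OF assms(2,3) i(1)] i(2) by (simp add: powr_powr)
  \<comment> \<open>The term of a maximizing index is one summand of a sum of non-negative
    terms.\<close>
  also have "\<dots> \<le> F_pow a l f X"
    unfolding F_pow_def using assms(1) i(1)
    by (intro powr_mono2 member_le_sum) auto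
  finally show ?thesis .
qed

lemma F_pow_le_F_max:
  assumes "0 < a" "modular_data V l f" "X \<subseteq> V"
  shows "F_pow a l f X \<le> real l powr (1 / a) * F_max l f X"
proof -
  have "1 \<le> l" using assms(2) by (simp add: modular_data_def)
  \<comment> \<open>Since \<open>1 \<le> l\<close>, index 1 is available, and the maximum dominates
    its non-negative value.\<close>
  then have nonneg: "0 \<le> F_max l f X"
    using modular_val_nonneg[OF assms(2,3), of 1] modular_val_le_F_max[of 1 l f X] by simp
  have "(\<Sum>i = 1..l. modular_val (f i) X powr a) \<le> (\<Sum>i = 1..l. F_max l f X powr a)"
    using assms(1) modular_val_nonneg[OF assms(2,3)] modular_val_le_F_max[of _ l f X]
    by (intro sum_mono powr_mono2) auto
  then have "F_pow a l f X \<le> (real l * F_max l f X powr a) powr (1 / a)"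
    unfolding F_pow_def using assms(1) by (intro powr_mono2 sum_nonneg) auto
  also have "\<dots> = real l powr (1 / a) * F_max l f X"
    using assms(1) nonneg by (simp add: powr_mult powr_powr)
  finally show ?thesis .
qed

lemma approx_min_transfer:
  fixes g h :: "'b \<Rightarrow> real"
  assumes "finite S" "Y \<in> S" "0 \<le> \<beta>"
    and lower: "\<And>X. X \<in> S \<Longrightarrow> g X \<le> h X"
    and upper: "\<And>X. X \<in> S \<Longrightarrow> h X \<le> c * g X"
    and approx: "h Y \<le> \<beta> * Min (h ` S)"
  shows "g Y \<le> \<beta> * c * Min (g ` S)"
proof -
  \<comment> \<open>\<open>Y\<close> witnesses that \<open>S\<close> is nonempty, so the minimum is
    attained.\<close>
  have "Min (g ` S) \<in> g ` S" using assms(1,2) by (intro Min_in) auto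
  then obtain Z where Z: "Z \<in> S" "Min (g ` S) = g Z" by auto
  have "g Y \<le> \<beta> * Min (h ` S)" using lower[OF assms(2)] approx by simp
  also have "\<dots> \<le> \<beta> * (c * g Z)"
  proof (rule mult_left_mono)
    have "Min (h ` S) \<le> h Z" using assms(1) Z(1) by simp
    then show "Min (h ` S) \<le> c * g Z" using upper[OF Z(1)] by simp
  qed fact
  finally show ?thesis by (simp add: Z(2) mult.assoc)
qed

text \<open>The algorithm for the power objective is run unchanged on the same words, so its running time
  bound carries over, and only the guarantee on the output has to be compared.\<close>

lemma approx_algorithm_robust_min:
  fixes inst :: "bool list \<Rightarrow> 'v robust_instance"
  assumes "0 < a" "\<forall>x\<in>I. valid_instance (inst x)" "0 \<le> \<beta>"
    and "approx_algorithm M (\<lambda>_. \<beta>) (power_min a I inst dec)"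
  shows "approx_algorithm M (\<lambda>x. \<beta> * real (num (inst x)) powr (1 / a)) (robust_min I inst dec)"
proof -
  let ?g = "\<lambda>x. F_max (num (inst x)) (weight (inst x))"
  let ?h = "\<lambda>x. F_pow a (num (inst x)) (weight (inst x))"
  obtain p :: "nat poly" where "finite (dom M)" and
    p: "\<forall>x\<in>I. \<exists>y. computes_within M x y (poly p (length x)) \<and> dec x y \<in> family (inst x) \<and>
          ?h x (dec x y) \<le> \<beta> * Min (?h x ` family (inst x))"
    using assms(4) unfolding approx_algorithm_def power_min_def min_problem.simps by blast
  have "\<exists>y. computes_within M x y (poly p (length x)) \<and> dec x y \<in> family (inst x) \<and>
          ?g x (dec x y) \<le> \<beta> * real (num (inst x)) powr (1 / a) * Min (?g x ` family (inst x))"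
    if x: "x \<in> I" for x
  proof -
    obtain y where y: "computes_within M x y (poly p (length x))" "dec x y \<in> family (inst x)"
      "?h x (dec x y) \<le> \<beta> * Min (?h x ` family (inst x))"
      using p x by blast
    have data: "modular_data (ground (inst x)) (num (inst x)) (weight (inst x))"
      and sub: "family (inst x) \<subseteq> Pow (ground (inst x))"
      using assms(2) x by (auto simp: valid_instance_def)
    \<comment> \<open>The family lies in the power set of a finite ground set; hence
      \<open>Min\<close> over it is a genuine minimum.\<close>
    have "finite (family (inst x))"
      using data sub finite_subset by (auto simp: modular_data_def)
    then have "?g x (dec x y) \<le>
        \<beta> * real (num (inst x)) powr (1 / a) * Min (?g x ` family (inst x))"
      using y(2) assms(3)
    proof (rule approx_min_transfer[where g = "?g x" and h = "?h x", OF _ _ _ _ _ y(3)])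
      fix X assume "X \<in> family (inst x)"
      then have "X \<subseteq> ground (inst x)" using sub by auto
      then show "?g x X \<le> ?h x X" and "?h x X \<le> real (num (inst x)) powr (1 / a) * ?g x X"
        using F_max_le_F_pow[OF assms(1) data] F_pow_le_F_max[OF assms(1) data] by auto
    qed
    with y(1,2) show ?thesis by (intro exI conjI)
  qed
  then show ?thesis
    using \<open>finite (dom M)\<close>
    unfolding approx_algorithm_def robust_min_def min_problem.simps
    by (intro conjI exI[of _ p] ballI)
qed

theorem lemma3:
  fixes a :: real
  assumes "a > 0"
  shows
    "(\<forall>(V :: 'v set) l f. modular_data V l f \<longrightarrow>
        (\<forall>X \<subseteq> V. F_max l f X \<le> F_pow a l f X \<and>
                  F_pow a l f X \<le> real l powr (1 / a) * F_max l f X)) \<and>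
     (\<forall>(I :: bool list set) (inst :: bool list \<Rightarrow> 'v robust_instance) dec M (\<beta> :: real).
        (\<forall>x\<in>I. valid_instance (inst x)) \<longrightarrow> 1 \<le> \<beta> \<longrightarrow>
        approx_algorithm M (\<lambda>_. \<beta>) (power_min a I inst dec) \<longrightarrow>
        approx_algorithm M (\<lambda>x. \<beta> * real (num (inst x)) powr (1 / a)) (robust_min I inst dec))"
proof (intro conjI allI impI)
  fix V :: "'v set" and l :: nat and f :: "nat \<Rightarrow> 'v \<Rightarrow> real" and X :: "'v set"
  assume "modular_data V l f" "X \<subseteq> V"
  with assms show "F_max l f X \<le> F_pow a l f X"
    and "F_pow a l f X \<le> real l powr (1 / a) * F_max l f X"
    by (auto intro: F_max_le_F_pow F_pow_le_F_max)
next
  fix I :: "bool list set" and inst :: "bool list \<Rightarrow> 'v robust_instance" and dec M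
    and \<beta> :: real
  assume "\<forall>x\<in>I. valid_instance (inst x)" "1 \<le> \<beta>"
    "approx_algorithm M (\<lambda>_. \<beta>) (power_min a I inst dec)"
  with assms show
    "approx_algorithm M (\<lambda>x. \<beta> * real (num (inst x)) powr (1 / a)) (robust_min I inst dec)"
    by (intro approx_algorithm_robust_min) simp_all
qed

end
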